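(* Let $W=(w_{i,j})\in\mathbb{R}_+^{n\times k}$ and $\varepsilon\in\mathbb{R}_+$. If $\bar I(\varepsilon)$ is $\varepsilon$-negligible and $\varepsilon\le L_W(\varepsilon)$, then the convex hull of $\mathcal{M}(W,\mathbf 0,\varepsilon)$ is given by $$\{(y,z)\in\mathbb{R}^k\times[0,1]^n:\ (y_j,\mathbf 1-z)\in\mathrm{conv}(Q_{f_j})\ \forall j\in[k],\ \ (y_1+\cdots+y_k,\mathbf 1-z)\in\mathrm{conv}(Q_g)\}.$$
   Context: $n,k\ge1$ are integers, $[n]=\{1,\dots,n\}$, $\mathbf 1$ is the all-ones vector. $\mathcal{M}(W,\mathbf 0,\varepsilon)=\{(y,z)\in\mathbb{R}^k\times\{0,1\}^n:\ y_j+w_{i,j}z_i\ge w_{i,j}\ \forall i\in[n],j\in[k];\ y_j\ge0\ \forall j\in[k];\ \sum_{j\in[k]}y_j\ge\varepsilon\}$. For $z\in\{0,1\}^n$: $f_j(z)=\max_{i\in[n]}\{w_{i,j}z_i\}$ for $j\in[k]$, and $g(z)=\max\{\varepsilon,\sum_{j\in[k]}f_j(z)\}$. For $f:\{0,1\}^n\to\mathbb{R}$, $Q_f=\{(y,z)\in\mathbb{R}\times\{0,1\}^n:y\ge f(z)\}$. $\bar I(\varepsilon)=\{i\in[n]:\sum_{j\in[k]}w_{i,j}\le\varepsilon\}$. It is $\varepsilon$-negligible if either $\bar I(\varepsilon)=\emptyset$, or $\bar I(\varepsilon)\ne\emptyset$ and both (C1) $\max_{i\in\bar I(\varepsilon)}w_{i,j}\le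 w_{i',j}$ for every $i'\in[n]\setminus\bar I(\varepsilon)$ and $j\in[k]$, and (C2) $\sum_{j\in[k]}\max_{i\in\bar I(\varepsilon)}w_{i,j}\le\varepsilon$. $L_W(\varepsilon)=\min_{p,q\in[n]\setminus\bar I(\varepsilon)}\sum_{j\in[k]}\min\{w_{p,j},w_{q,j}\}$ ($p=q$ allowed) if $\bar I(\varepsilon)\ne[n]$, and $L_W(\varepsilon)=+\infty$ if $\bar I(\varepsilon)=[n]$. *)

theory Defs
  imports "HOL-Analysis.Analysis"
begin

text \<open>The index sets \<open>[n]\<close> and \<open>[k]\<close> are the finite types \<open>'n\<close> and \<open>'k\<close>, so
  \<open>n, k \<ge> 1\<close> is automatic. The entry \<open>w\<^sub>i\<^sub>,\<^sub>j\<close> is \<open>W $ i $ j\<close>.\<close>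

definition binary_vectors :: "(real^'n) set" where
  "binary_vectors = {z. \<forall>i. z $ i \<in> {0, 1}}"

text \<open>The joint mixing set \<open>M(W, l, \<epsilon>)\<close> with lower bounds \<open>l = 0\<close>.\<close>

definition joint_mixing_set :: "real^'k^'n \<Rightarrow> real \<Rightarrow> ((real^'k) \<times> (real^'n)) set" where
  "joint_mixing_set W \<epsilon> =
     {(y, z). z \<in> binary_vectors \<and>
        (\<forall>i j. y $ j + W $ i $ j * z $ i \<ge> W $ i $ j) \<and>
        (\<forall>j. y $ j \<ge> 0) \<and>
        (\<Sum>j\<in>UNIV. y $ j) \<ge> \<epsilon>}"

definition f_mix :: "real^'k^'n \<Rightarrow> 'k \<Rightarrow> real^'n \<Rightarrow> real" where
  "f_mix W j z = Max (range (\<lambda>i. W $ i $ j * z $ i))"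

definition g_mix :: "real^'k^'n \<Rightarrow> real \<Rightarrow> real^'n \<Rightarrow> real" where
  "g_mix W \<epsilon> z = max \<epsilon> (\<Sum>j\<in>UNIV. f_mix W j z)"

text \<open>\<open>Q_epi h\<close> depends only on the values of \<open>h\<close> on binary vectors.\<close>

definition Q_epi :: "(real^'n \<Rightarrow> real) \<Rightarrow> (real \<times> (real^'n)) set" where
  "Q_epi h = {(y, z). z \<in> binary_vectors \<and> y \<ge> h z}"

definition I_bar :: "real^'k^'n \<Rightarrow> real \<Rightarrow> 'n set" where
  "I_bar W \<epsilon> = {i. (\<Sum>j\<in>UNIV. W $ i $ j) \<le> \<epsilon>}"

definition negligible_I_bar :: "real^'k^'n \<Rightarrow> real \<Rightarrow> bool" where
  "negligible_I_bar W \<epsilon> \<longleftrightarrow>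
     I_bar W \<epsilon> = {} \<or>
     (I_bar W \<epsilon> \<noteq> {} \<and>
      (\<forall>i'\<in>- I_bar W \<epsilon>. \<forall>j. Max ((\<lambda>i. W $ i $ j) ` I_bar W \<epsilon>) \<le> W $ i' $ j) \<and>
      (\<Sum>j\<in>UNIV. Max ((\<lambda>i. W $ i $ j) ` I_bar W \<epsilon>)) \<le> \<epsilon>)"

definition L_W :: "real^'k^'n \<Rightarrow> real \<Rightarrow> ereal" where
  "L_W W \<epsilon> =
     (if I_bar W \<epsilon> = UNIV then \<infinity>
      else ereal (Min {\<Sum>j\<in>UNIV. min (W $ p $ j) (W $ q $ j) | p q.
                         p \<in> - I_bar W \<epsilon> \<and> q \<in> - I_bar W \<epsilon>}))"

end

theory Submission
  imports Defs
begin

text \<open>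
  Complementing the binary part, \<open>x = 1 - z\<close>, turns the joint mixing set into the set of all
  \<open>(y, x)\<close> with \<open>x\<close> binary, \<open>y\<^sub>j \<ge> f\<^sub>j x\<close> for each \<open>j\<close>, and \<open>\<Sum>\<^sub>j y\<^sub>j \<ge> g x\<close>
  (\<open>complement_mem_joint_mixing_set_iff\<close>). The right-hand side of the theorem convexifies each of
  these constraints separately, so it is convex and contains the mixing set. What has to be shown is
  that nothing is lost by convexifying them one at a time.

  The reason is that one and the same convex combination of binary points serves all the
  constraints, because \<open>f\<^sub>j\<close> and \<open>g\<close> are submodular. Ordering the coordinates of \<open>x\<close> decreasingly
  writes \<open>x\<close> as a convex combination \<open>\<Sum>\<^sub>t \<lambda>\<^sub>t 1\<^bsub>S t\<^esub>\<close> over the chain of the initial segments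
  \<open>S t\<close> of this order (\<open>chain_decomposition\<close>). A submodular \<open>h\<close> has an affine
  minorant that agrees with it on the whole chain (\<open>greedy_affine_minorant\<close>), hence
  \<open>(y, x) \<in> conv Q\<^sub>h\<close> forces \<open>y \<ge> \<Sum>\<^sub>t \<lambda>\<^sub>t h (S t)\<close> (\<open>Lovasz_extension_le\<close>). The chain and the
  weights depend on \<open>x\<close> only, so the bounds for all the \<open>f\<^sub>j\<close> and for \<open>g\<close> refer to the same
  convex combination.

  It remains to split \<open>y\<close> along the chain. The slacks \<open>s\<^sub>j = y\<^sub>j - \<Sum>\<^sub>t \<lambda>\<^sub>t f\<^sub>j (S t)\<close> are nonnegative
  and their total covers the average of the deficits \<open>d t = g (S t) - \<Sum>\<^sub>j f\<^sub>j (S t)\<close>. Handing every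
  slack to the chain elements in proportion to their deficits gives points of the mixing set that
  average to \<open>(y, z)\<close> (\<open>split_along_weights\<close>).

  Negligibility and the bound on \<open>\<epsilon>\<close> serve to make \<open>g\<close> submodular (\<open>submodular_g_mix\<close>).
  By negligibility, \<open>g\<close> is the constant \<open>\<epsilon>\<close> on the subsets of \<open>I_bar\<close>, and adding elements of
  \<open>I_bar\<close> to any other set does not change \<open>g\<close>. The bound \<open>\<epsilon> \<le> L_W\<close> covers two sets that leave
  \<open>I_bar\<close> while their intersection stays inside it.
\<close>

section \<open>Submodular functions and their convex epigraphs\<close>

definition ind :: "'n set \<Rightarrow> real^'n" where
  "ind A = (\<chi> i. if i \<in> A then 1 else 0)"

lemma ind_nth [simp]: "ind A $ i = (if i \<in> A then 1 else 0)"
  by (simp add: ind_def)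

lemma binary_vectors_eq_range_ind: "binary_vectors = range ind"
proof (intro equalityI subsetI)
  fix z :: "real^'n" assume z: "z \<in> binary_vectors"
  have "z = ind {i. z $ i = 1}"
    using z by (auto simp: vec_eq_iff binary_vectors_def)
  then show "z \<in> range ind" by blast
qed (auto simp: binary_vectors_def)

lemma complement_mem_binary_vectors:
  "z \<in> binary_vectors \<Longrightarrow> 1 - z \<in> binary_vectors"
  by (auto simp: binary_vectors_def)

definition submodular :: "('n set \<Rightarrow> real) \<Rightarrow> bool" where
  "submodular h \<longleftrightarrow> (\<forall>A B. h (A \<union> B) + h (A \<inter> B) \<le> h A + h B)"

text \<open>Edmonds' greedy construction: the coefficient of an element is the increment of \<open>h\<close> at the
  moment the element joins the chain. This makes the affine function tight on the chain by
  telescoping. It stays below \<open>h\<close> elsewhere since, by submodularity, the increment that an element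
  causes in \<open>A\<close> is at least the increment that it causes in the larger initial segment.\<close>

lemma greedy_affine_minorant:
  fixes h :: "'n::finite set \<Rightarrow> real" and v :: "nat \<Rightarrow> 'n"
  assumes sub: "submodular h" and v: "bij_betw v {..<N} UNIV"
  obtains a where "\<And>A. h {} + sum a A \<le> h A"
    and "\<And>t. t \<le> N \<Longrightarrow> h {} + sum a (v ` {..<t}) = h (v ` {..<t})"
proof
  define S where "S t = v ` {..<t}" for t
  define r where "r = the_inv_into {..<N} v"
  define a where "a i = h (S (Suc (r i))) - h (S (r i))" for i
  have inj: "inj_on v {..<N}" using v by (rule bij_betw_imp_inj_on)
  have S_Suc: "S (Suc t) = insert (v t) (S t)" for t
    by (auto simp: S_def lessThan_Suc)
  have new: "v t \<notin> S t" if "t < N" for t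
    using that by (subst S_def, subst inj_on_image_mem_iff[OF inj]) auto
  have a_v: "a (v t) = h (S (Suc t)) - h (S t)" if "t < N" for t
    using inj that by (simp add: a_def r_def the_inv_into_f_f)
  have tight: "h {} + sum a (S t) = h (S t)" if "t \<le> N" for t
    using that
  proof (induction t)
    case 0
    then show ?case by (simp add: S_def)
  next
    case (Suc t)
    then have "h {} + sum a (S (Suc t)) = a (v t) + h (S t)"
      using new[of t] by (simp add: S_Suc)
    then show ?case using Suc.prems by (simp add: a_v)
  qed
  show "h {} + sum a (v ` {..<t}) = h (v ` {..<t})" if "t \<le> N" for t
    using tight[OF that] by (simp add: S_def)
  fix A
  have "h {} + sum a (A \<inter> S t) \<le> h (A \<inter> S t)" if "t \<le> N" for t
    using that
  proof (induction t)
    case 0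
    then show ?case by (simp add: S_def)
  next
    case (Suc t)
    show ?case
    proof (cases "v t \<in> A")
      case True
      have un: "(A \<inter> S (Suc t)) \<union> S t = S (Suc t)"
        and int: "(A \<inter> S (Suc t)) \<inter> S t = A \<inter> S t"
        using True by (auto simp: S_Suc)
      have "h (S (Suc t)) + h (A \<inter> S t) \<le> h (A \<inter> S (Suc t)) + h (S t)"
        using sub[unfolded submodular_def, rule_format, of "A \<inter> S (Suc t)" "S t"]
        unfolding un int .
      moreover have "sum a (A \<inter> S (Suc t)) = a (v t) + sum a (A \<inter> S t)"
        using True new[of t] Suc.prems by (simp add: S_Suc)
      ultimately show ?thesis using Suc by (simp add: a_v)
    next
      case False
      then show ?thesis using Suc by (simp add: S_Suc)
    qed
  qed
  from this[of N] show "h {} + sum a A \<le> h A"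
    using bij_betw_imp_surj_on[OF v] by (simp add: S_def)
qed

text \<open>The sum on the left is the Lovasz extension of \<open>h\<close> at \<open>x\<close>. The affine minorant that is tight
  on the chain cuts out a half-space that contains \<open>Q_epi\<close>, hence its convex hull, and its value
  at \<open>x\<close> is that sum.\<close>

lemma Lovasz_extension_le:
  fixes h :: "real^'n \<Rightarrow> real" and v :: "nat \<Rightarrow> 'n"
  assumes sub: "submodular (\<lambda>A. h (ind A))" and v: "bij_betw v {..<N} UNIV"
    and sum1: "sum l {..N} = 1"
    and x: "x = (\<Sum>t\<le>N. l t *\<^sub>R ind (v ` {..<t}))"
    and mem: "(y, x) \<in> convex hull (Q_epi h)"
  shows "(\<Sum>t\<le>N. l t * h (ind (v ` {..<t}))) \<le> y"
proof -
  obtain a where le: "\<And>A. h (ind {}) + sum a A \<le> h (ind A)"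
    and tight: "\<And>t. t \<le> N \<Longrightarrow> h (ind {}) + sum a (v ` {..<t}) = h (ind (v ` {..<t}))"
    using greedy_affine_minorant[OF sub v] by metis
  define m where "m z = (\<Sum>i\<in>UNIV. a i * z $ i)" for z :: "real^'n"
  have m_ind: "m (ind A) = sum a A" for A
    by (simp add: m_def if_distrib sum.If_cases cong: if_cong)
  have lin: "linear m"
    by (rule linearI)
      (simp_all add: m_def algebra_simps sum.distrib sum_distrib_left)
  let ?H = "{p. h (ind {}) + m (snd p) \<le> fst p}"
  have "Q_epi h \<subseteq> ?H"
    using le order_trans by (fastforce simp: Q_epi_def binary_vectors_eq_range_ind m_ind)
  moreover have "convex ?H"
  proof (rule convexI)
    fix p q :: "real \<times> (real^'n)" and c d :: real
    assume p: "p \<in> ?H" and q: "q \<in> ?H" and cd: "0 \<le> c" "0 \<le> d" "c + d = 1"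
    have "c * (h (ind {}) + m (snd p)) + d * (h (ind {}) + m (snd q)) \<le> c * fst p + d * fst q"
      using p q cd by (intro add_mono mult_left_mono) auto
    moreover have "c * h (ind {}) + d * h (ind {}) = h (ind {})"
      using cd by (simp flip: distrib_right)
    ultimately show "c *\<^sub>R p + d *\<^sub>R q \<in> ?H"
      by (simp add: linear_add[OF lin] linear_scale[OF lin] algebra_simps)
  qed
  ultimately have "convex hull (Q_epi h) \<subseteq> ?H" by (rule hull_minimal)
  then have "h (ind {}) + m x \<le> y" using mem by auto
  moreover have "m x = (\<Sum>t\<le>N. l t * sum a (v ` {..<t}))"
    by (simp add: x linear_sum[OF lin] linear_scale[OF lin] m_ind)
  moreover have "(\<Sum>t\<le>N. l t * h (ind (v ` {..<t})))
      = (\<Sum>t\<le>N. l t * (h (ind {}) + sum a (v ` {..<t})))"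
    using tight by (intro sum.cong) auto
  moreover have "\<dots> = h (ind {}) + (\<Sum>t\<le>N. l t * sum a (v ` {..<t}))"
    using sum1 by (simp add: distrib_left sum.distrib flip: sum_distrib_right)
  ultimately show ?thesis by simp
qed

text \<open>The weights are the gaps in the decreasing rearrangement of \<open>x\<close>, framed by \<open>1\<close> and \<open>0\<close>; both
  sums telescope. The empty segment is part of the chain, so that the weights add up to \<open>1\<close>.\<close>

lemma chain_decomposition:
  fixes x :: "real^'n"
  assumes x: "\<And>i. x $ i \<in> {0..1}"
  obtains v :: "nat \<Rightarrow> 'n" and N l where "bij_betw v {..<N} UNIV" "\<And>t. 0 \<le> l t"
    "sum l {..N} = 1" "x = (\<Sum>t\<le>N. l t *\<^sub>R ind (v ` {..<t}))"
proof -
  obtain us :: "'n list" where us: "set us = UNIV" "distinct us"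
    using finite_distinct_list[OF finite] by metis
  define xs where "xs = sort_key (\<lambda>i. - x $ i) us"
  define N where "N = length xs"
  define v where "v = nth xs"
  have xs: "set xs = UNIV" "distinct xs" "sorted (map (\<lambda>i. - x $ i) xs)"
    using us by (simp_all add: xs_def)
  have v: "bij_betw v {..<N} UNIV"
    unfolding v_def by (rule bij_betw_nth) (auto simp: xs N_def)
  have dec: "x $ v t \<le> x $ v s" if "s \<le> t" "t < N" for s t
    using sorted_nth_mono[OF xs(3) that(1)] that by (simp add: N_def v_def)
  define X where "X t = (if t = 0 then 1 else if t \<le> N then x $ v (t - 1) else 0)" for t
  define l where "l t = X t - X (Suc t)" for t
  have X_bounds: "0 \<le> X t" "X t \<le> 1" for t
    using x by (auto simp: X_def)
  have "0 \<le> l t" for t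
  proof (cases "t = 0 \<or> N \<le> t")
    case True
    then show ?thesis using X_bounds[of "Suc t"] X_bounds[of t] by (auto simp: l_def X_def)
  next
    case False
    then show ?thesis using dec[of "t - 1" t] by (simp add: l_def X_def)
  qed
  moreover have tele: "sum l {s..N} = X s" if "s \<le> Suc N" for s
    using sum_Suc_diff[OF that, of X] sum_negf[of l "{s..N}"]
    by (simp add: l_def X_def sum_subtractf)
  then have "sum l {..N} = 1"
    using tele[of 0] by (simp add: X_def atMost_atLeast0)
  moreover have "x = (\<Sum>t\<le>N. l t *\<^sub>R ind (v ` {..<t}))"
  proof (rule vec_eq_iff[THEN iffD2], rule allI)
    fix i
    obtain s where s: "s < N" "i = v s"
      using bij_betw_imp_surj_on[OF v] by (metis UNIV_I imageE lessThan_iff)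
    have "i \<in> v ` {..<t} \<longleftrightarrow> s < t" if "t \<le> N" for t
      unfolding s(2) using s(1) that
      by (subst inj_on_image_mem_iff[OF bij_betw_imp_inj_on[OF v]]) auto
    then have "(\<Sum>t\<le>N. l t *\<^sub>R ind (v ` {..<t})) $ i = (\<Sum>t\<le>N. if s < t then l t else 0)"
      by (auto simp: sum_component intro!: sum.cong)
    also have "\<dots> = sum l {Suc s..N}"
      by (auto simp: sum.If_cases intro!: sum.cong)
    also have "\<dots> = x $ i"
      using s by (subst tele) (auto simp: X_def)
    finally show "x $ i = (\<Sum>t\<le>N. l t *\<^sub>R ind (v ` {..<t})) $ i" by simp
  qed
  ultimately show thesis using that v by blast
qed

section \<open>Submodularity of the component bounds and of the bound on the sum\<close>

text \<open>The coordinates outside \<open>A\<close> contribute the bound \<open>0 \<le> c\<close>. When \<open>A = UNIV\<close> there are none,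
  but then \<open>W \<ge> 0\<close> gives this bound, so the characterization is uniform in \<open>A\<close>.\<close>

lemma f_mix_ind_le_iff:
  fixes W :: "real^'k^'n"
  assumes "\<And>i j. 0 \<le> W $ i $ j"
  shows "f_mix W j (ind A) \<le> c \<longleftrightarrow> 0 \<le> c \<and> (\<forall>i\<in>A. W $ i $ j \<le> c)"
proof -
  have "f_mix W j (ind A) \<le> c \<longleftrightarrow> (\<forall>i. W $ i $ j * ind A $ i \<le> c)"
    by (simp add: f_mix_def del: ind_nth)
  also have "\<dots> \<longleftrightarrow> 0 \<le> c \<and> (\<forall>i\<in>A. W $ i $ j \<le> c)"
  proof
    assume le: "\<forall>i. W $ i $ j * ind A $ i \<le> c"
    have "0 \<le> W $ i $ j * ind A $ i" for i using assms by simp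
    with le have "0 \<le> c" using order_trans by blast
    moreover have "W $ i $ j \<le> c" if "i \<in> A" for i using le[rule_format, of i] that by simp
    ultimately show "0 \<le> c \<and> (\<forall>i\<in>A. W $ i $ j \<le> c)" by blast
  qed simp
  finally show ?thesis .
qed

lemma f_mix_ind_nonneg:
  assumes "\<And>i j. 0 \<le> W $ i $ j"
  shows "0 \<le> f_mix W j (ind A)"
  using f_mix_ind_le_iff[OF assms] by blast

lemma le_f_mix_ind:
  assumes "\<And>i j. 0 \<le> W $ i $ j" "i \<in> A"
  shows "W $ i $ j \<le> f_mix W j (ind A)"
  using f_mix_ind_le_iff[OF assms(1)] assms(2) by blast

lemma f_mix_ind_mono:
  assumes "\<And>i j. 0 \<le> W $ i $ j" "A \<subseteq> B"
  shows "f_mix W j (ind A) \<le> f_mix W j (ind B)"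
  using assms by (auto simp: f_mix_ind_le_iff f_mix_ind_nonneg le_f_mix_ind)

lemma f_mix_ind_Un:
  assumes "\<And>i j. 0 \<le> W $ i $ j"
  shows "f_mix W j (ind (A \<union> B)) = max (f_mix W j (ind A)) (f_mix W j (ind B))"
proof (rule antisym)
  show "f_mix W j (ind (A \<union> B)) \<le> max (f_mix W j (ind A)) (f_mix W j (ind B))"
    unfolding f_mix_ind_le_iff[OF assms, where A = "A \<union> B"]
  proof (intro conjI ballI)
    show "W $ i $ j \<le> max (f_mix W j (ind A)) (f_mix W j (ind B))" if "i \<in> A \<union> B" for i
      using that by (auto simp: le_max_iff_disj le_f_mix_ind[OF assms])
  qed (simp add: le_max_iff_disj f_mix_ind_nonneg[OF assms])
qed (simp add: assms f_mix_ind_mono)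

text \<open>A maximum over a union is the larger of the two maxima, and a maximum over an intersection is
  at most the smaller one.\<close>

lemma submodular_f_mix:
  assumes "\<And>i j. 0 \<le> W $ i $ j"
  shows "submodular (\<lambda>A. f_mix W j (ind A))"
  unfolding submodular_def
proof (intro allI)
  fix A B
  show "f_mix W j (ind (A \<union> B)) + f_mix W j (ind (A \<inter> B)) \<le> f_mix W j (ind A) + f_mix W j (ind B)"
    using f_mix_ind_mono[OF assms, of "A \<inter> B" A j] f_mix_ind_mono[OF assms, of "A \<inter> B" B j]
    by (auto simp: f_mix_ind_Un[OF assms] max_def)
qed

lemma g_mix_ind_inside_I_bar:
  assumes W: "\<And>i j. 0 \<le> W $ i $ j" and "0 \<le> \<epsilon>" and neg: "negligible_I_bar W \<epsilon>"
    and A: "A \<subseteq> I_bar W \<epsilon>"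
  shows "g_mix W \<epsilon> (ind A) = \<epsilon>"
proof -
  have "(\<Sum>j\<in>UNIV. f_mix W j (ind A)) \<le> \<epsilon>"
  proof (cases "A = {}")
    case True
    then have "f_mix W j (ind A) \<le> 0" for j
      by (simp add: f_mix_ind_le_iff[OF W])
    then show ?thesis
      using \<open>0 \<le> \<epsilon>\<close> by (meson order_trans sum_nonpos)
  next
    case False
    let ?M = "\<lambda>j. Max ((\<lambda>i. W $ i $ j) ` I_bar W \<epsilon>)"
    have le: "W $ i $ j \<le> ?M j" if "i \<in> I_bar W \<epsilon>" for i j
      using that by (intro Max_ge) auto
    have "f_mix W j (ind A) \<le> ?M j" for j
    proof -
      obtain i where "i \<in> A" using False by blast
      then have "0 \<le> ?M j" using A le W order_trans by blast
      then show ?thesis using A le by (auto simp: f_mix_ind_le_iff[OF W])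
    qed
    then have "(\<Sum>j\<in>UNIV. f_mix W j (ind A)) \<le> (\<Sum>j\<in>UNIV. ?M j)"
      by (intro sum_mono)
    also have "\<dots> \<le> \<epsilon>" using neg False A by (auto simp: negligible_I_bar_def)
    finally show ?thesis .
  qed
  then show ?thesis by (simp add: g_mix_def)
qed

lemma g_mix_ind_outside_I_bar:
  assumes W: "\<And>i j. 0 \<le> W $ i $ j" and A: "\<not> A \<subseteq> I_bar W \<epsilon>"
  shows "g_mix W \<epsilon> (ind A) = (\<Sum>j\<in>UNIV. f_mix W j (ind A))"
proof -
  obtain p where p: "p \<in> A" "p \<notin> I_bar W \<epsilon>" using A by blast
  then have "\<epsilon> < (\<Sum>j\<in>UNIV. W $ p $ j)" by (simp add: I_bar_def)
  also have "\<dots> \<le> (\<Sum>j\<in>UNIV. f_mix W j (ind A))"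
    using p(1) by (intro sum_mono le_f_mix_ind[OF W])
  finally show ?thesis by (simp add: g_mix_def)
qed

text \<open>Elements of \<open>I_bar\<close> are dominated by every element outside it, in each coordinate.\<close>

lemma f_mix_ind_absorbs_I_bar:
  assumes W: "\<And>i j. 0 \<le> W $ i $ j" and neg: "negligible_I_bar W \<epsilon>"
    and A: "\<not> A \<subseteq> I_bar W \<epsilon>" and B: "B \<subseteq> I_bar W \<epsilon>"
  shows "f_mix W j (ind (A \<union> B)) = f_mix W j (ind A)"
proof -
  obtain p where p: "p \<in> A" "p \<notin> I_bar W \<epsilon>" using A by blast
  have "W $ i $ j \<le> f_mix W j (ind A)" if "i \<in> B" for i
  proof -
    have i: "i \<in> I_bar W \<epsilon>" using that B by blast
    then have "W $ i $ j \<le> Max ((\<lambda>i. W $ i $ j) ` I_bar W \<epsilon>)"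
      by (intro Max_ge) auto
    also have "\<dots> \<le> W $ p $ j" using neg i p(2) by (auto simp: negligible_I_bar_def)
    also have "\<dots> \<le> f_mix W j (ind A)" using W p(1) by (rule le_f_mix_ind)
    finally show ?thesis .
  qed
  then have "f_mix W j (ind B) \<le> f_mix W j (ind A)"
    by (simp add: f_mix_ind_le_iff[OF W, where A = B] f_mix_ind_nonneg[OF W])
  then show ?thesis by (simp add: f_mix_ind_Un[OF W])
qed

lemma le_sum_min_if_le_L_W:
  assumes L: "ereal \<epsilon> \<le> L_W W \<epsilon>" and p: "p \<notin> I_bar W \<epsilon>" and q: "q \<notin> I_bar W \<epsilon>"
  shows "\<epsilon> \<le> (\<Sum>j\<in>UNIV. min (W $ p $ j) (W $ q $ j))"
proof -
  let ?s = "\<lambda>p q. \<Sum>j\<in>UNIV. min (W $ p $ j) (W $ q $ j)"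
  let ?M = "{?s p q | p q. p \<in> - I_bar W \<epsilon> \<and> q \<in> - I_bar W \<epsilon>}"
  have "finite ?M"
    by (rule finite_subset[of _ "(\<lambda>(p, q). ?s p q) ` UNIV"]) auto
  moreover have "?s p q \<in> ?M" using p q by auto
  ultimately have "Min ?M \<le> ?s p q" by (rule Min_le)
  moreover have "L_W W \<epsilon> = ereal (Min ?M)" using p by (auto simp: L_W_def)
  then have "\<epsilon> \<le> Min ?M" using L by (simp del: Compl_iff)
  ultimately show ?thesis by linarith
qed

text \<open>If \<open>A\<close> or \<open>B\<close> lies in \<open>I_bar\<close>, negligibility turns the inequality into an equality. If
  \<open>A \<inter> B\<close> leaves \<open>I_bar\<close>, all four values of \<open>g\<close> are sums of the submodular \<open>f\<^sub>j\<close>. The delicate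
  case is that of \<open>A\<close> and \<open>B\<close> leaving \<open>I_bar\<close> with an intersection inside it, where the value
  \<open>g (A \<inter> B) = \<epsilon>\<close> may be larger than \<open>\<Sum>\<^sub>j f\<^sub>j (A \<inter> B)\<close>. The identity \<open>a + b - max a b = min a b\<close>
  leaves the room \<open>\<Sum>\<^sub>j min (f\<^sub>j A) (f\<^sub>j B)\<close> for it, which is at least \<open>L_W W \<epsilon>\<close>.\<close>

lemma submodular_g_mix:
  assumes W: "\<And>i j. 0 \<le> W $ i $ j" and eps: "0 \<le> \<epsilon>" and neg: "negligible_I_bar W \<epsilon>"
    and L: "ereal \<epsilon> \<le> L_W W \<epsilon>"
  shows "submodular (\<lambda>A. g_mix W \<epsilon> (ind A))"
  unfolding submodular_def
proof (intro allI)
  note inside = g_mix_ind_inside_I_bar[OF W eps neg]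
  note outside = g_mix_ind_outside_I_bar[OF W]
  have mixed: "g_mix W \<epsilon> (ind (A \<union> B)) + g_mix W \<epsilon> (ind (A \<inter> B))
      \<le> g_mix W \<epsilon> (ind A) + g_mix W \<epsilon> (ind B)"
    if A: "\<not> A \<subseteq> I_bar W \<epsilon>" and B: "B \<subseteq> I_bar W \<epsilon>" for A B
  proof -
    have "\<not> A \<union> B \<subseteq> I_bar W \<epsilon>" "A \<inter> B \<subseteq> I_bar W \<epsilon>" using A B by auto
    then show ?thesis
      using A B by (simp add: inside outside f_mix_ind_absorbs_I_bar[OF W neg])
  qed
  fix A B
  consider "A \<subseteq> I_bar W \<epsilon>" "B \<subseteq> I_bar W \<epsilon>" | "\<not> A \<subseteq> I_bar W \<epsilon>" "B \<subseteq> I_bar W \<epsilon>"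
    | "A \<subseteq> I_bar W \<epsilon>" "\<not> B \<subseteq> I_bar W \<epsilon>"
    | "\<not> A \<subseteq> I_bar W \<epsilon>" "\<not> B \<subseteq> I_bar W \<epsilon>" "\<not> A \<inter> B \<subseteq> I_bar W \<epsilon>"
    | "\<not> A \<subseteq> I_bar W \<epsilon>" "\<not> B \<subseteq> I_bar W \<epsilon>" "A \<inter> B \<subseteq> I_bar W \<epsilon>"
    by blast
  then show "g_mix W \<epsilon> (ind (A \<union> B)) + g_mix W \<epsilon> (ind (A \<inter> B))
      \<le> g_mix W \<epsilon> (ind A) + g_mix W \<epsilon> (ind B)"
  proof cases
    case 1
    then have "A \<union> B \<subseteq> I_bar W \<epsilon>" "A \<inter> B \<subseteq> I_bar W \<epsilon>" by auto
    with 1 show ?thesis by (simp add: inside)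
  next
    case 2
    then show ?thesis by (rule mixed)
  next
    case 3
    then show ?thesis using mixed[of B A] by (simp add: Un_commute Int_commute add.commute)
  next
    case 4
    then have un: "\<not> A \<union> B \<subseteq> I_bar W \<epsilon>" by blast
    have "(\<Sum>j\<in>UNIV. f_mix W j (ind (A \<union> B)) + f_mix W j (ind (A \<inter> B)))
        \<le> (\<Sum>j\<in>UNIV. f_mix W j (ind A) + f_mix W j (ind B))"
      using submodular_f_mix[OF W] by (intro sum_mono) (auto simp: submodular_def)
    with 4 un show ?thesis by (simp add: outside sum.distrib)
  next
    case 5
    then have un: "\<not> A \<union> B \<subseteq> I_bar W \<epsilon>" by blast
    obtain p q where p: "p \<in> A" "p \<notin> I_bar W \<epsilon>" and q: "q \<in> B" "q \<notin> I_bar W \<epsilon>"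
      using 5 by blast
    have "\<epsilon> \<le> (\<Sum>j\<in>UNIV. min (W $ p $ j) (W $ q $ j))"
      using L p(2) q(2) by (rule le_sum_min_if_le_L_W)
    also have "\<dots> \<le> (\<Sum>j\<in>UNIV. min (f_mix W j (ind A)) (f_mix W j (ind B)))"
      using p(1) q(1) by (intro sum_mono min.mono le_f_mix_ind[OF W])
    also have "\<dots> = (\<Sum>j\<in>UNIV. f_mix W j (ind A) + f_mix W j (ind B) - f_mix W j (ind (A \<union> B)))"
      by (intro sum.cong) (auto simp: f_mix_ind_Un[OF W] min_def max_def)
    finally show ?thesis
      using 5 un by (simp add: inside outside sum.distrib sum_subtractf)
  qed
qed

section \<open>The convex hull of the joint mixing set\<close>

lemma complement_mem_joint_mixing_set_iff:
  assumes W: "\<And>i j. 0 \<le> W $ i $ j"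
  shows "(y, 1 - ind A) \<in> joint_mixing_set W \<epsilon> \<longleftrightarrow>
    (\<forall>j. f_mix W j (ind A) \<le> y $ j) \<and> g_mix W \<epsilon> (ind A) \<le> (\<Sum>j\<in>UNIV. y $ j)"
proof -
  have "1 - ind A \<in> binary_vectors"
    by (rule complement_mem_binary_vectors) (simp add: binary_vectors_eq_range_ind)
  moreover have "(\<forall>i. W $ i $ j \<le> y $ j + W $ i $ j * (1 - ind A) $ i) \<and> 0 \<le> y $ j
      \<longleftrightarrow> f_mix W j (ind A) \<le> y $ j" for j
    by (auto simp: f_mix_ind_le_iff[OF W])
  moreover have "(\<Sum>j\<in>UNIV. f_mix W j (ind A)) \<le> (\<Sum>j\<in>UNIV. y $ j)"
    if "\<forall>j. f_mix W j (ind A) \<le> y $ j"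
    using that by (intro sum_mono) blast
  ultimately show ?thesis
    unfolding joint_mixing_set_def g_mix_def mem_Collect_eq case_prod_conv max.bounded_iff by blast
qed

text \<open>Each component may have to give more than \<open>f t j\<close> so that the points reach the bounds \<open>g t\<close>
  on their sums. All components distribute their slack in the same proportions, those of the
  deficits \<open>g t - \<Sum>\<^sub>j f t j\<close>. The total slack is at least the weighted average of the deficits, so
  every deficit is covered at the points of positive weight.\<close>

lemma split_along_weights:
  fixes f :: "nat \<Rightarrow> 'k::finite \<Rightarrow> real" and y :: "real^'k"
  assumes l: "\<And>t. 0 \<le> l t" and sum1: "sum l {..N} = 1"
    and fg: "\<And>t. (\<Sum>j\<in>UNIV. f t j) \<le> g t"
    and yf: "\<And>j. (\<Sum>t\<le>N. l t * f t j) \<le> y $ j"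
    and yg: "(\<Sum>t\<le>N. l t * g t) \<le> (\<Sum>j\<in>UNIV. y $ j)"
  obtains Y :: "nat \<Rightarrow> real^'k" where "\<And>t j. f t j \<le> Y t $ j"
    and "\<And>t. t \<le> N \<Longrightarrow> 0 < l t \<Longrightarrow> g t \<le> (\<Sum>j\<in>UNIV. Y t $ j)"
    and "y = (\<Sum>t\<le>N. l t *\<^sub>R Y t)"
proof -
  define s where "s j = y $ j - (\<Sum>t\<le>N. l t * f t j)" for j
  define d where "d t = g t - (\<Sum>j\<in>UNIV. f t j)" for t
  define D where "D = (\<Sum>t\<le>N. l t * d t)"
  have s: "0 \<le> s j" for j using yf by (simp add: s_def)
  have d: "0 \<le> d t" for t using fg by (simp add: d_def)
  have D0: "0 \<le> D" using l d by (simp add: D_def sum_nonneg)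
  have "D = (\<Sum>t\<le>N. l t * g t) - (\<Sum>t\<le>N. \<Sum>j\<in>UNIV. l t * f t j)"
    by (simp add: D_def d_def right_diff_distrib sum_subtractf sum_distrib_left)
  also have "(\<Sum>t\<le>N. \<Sum>j\<in>UNIV. l t * f t j) = (\<Sum>j\<in>UNIV. \<Sum>t\<le>N. l t * f t j)"
    by (rule sum.swap)
  finally have Ds: "D \<le> sum s UNIV"
    using yg by (simp add: s_def sum_subtractf)
  \<comment> \<open>If \<open>D = 0\<close>, there is no deficit where the weight is positive, and the slack may be spread evenly.\<close>
  define c where "c t = (if D = 0 then 1 else d t / D)" for t
  have c0: "0 \<le> c t" for t using d D0 by (simp add: c_def)
  have c1: "(\<Sum>t\<le>N. l t * c t) = 1"
    using sum1 by (cases "D = 0") (simp_all add: c_def D_def flip: sum_divide_distrib)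
  have cd: "d t \<le> c t * sum s UNIV" if "t \<le> N" "0 < l t" for t
  proof (cases "D = 0")
    case True
    then have "l t * d t = 0"
      using l d that(1) by (simp add: D_def sum_nonneg_eq_0_iff)
    then show ?thesis using that(2) s by (simp add: c_def True sum_nonneg)
  next
    case False
    have "d t = c t * D" using False by (simp add: c_def)
    also have "\<dots> \<le> c t * sum s UNIV" using Ds c0 by (rule mult_left_mono)
    finally show ?thesis .
  qed
  let ?Y = "\<lambda>t. (\<chi> j. f t j + c t * s j) :: real^'k"
  show thesis
  proof
    show "f t j \<le> ?Y t $ j" for t j using c0 s by simp
    show "g t \<le> (\<Sum>j\<in>UNIV. ?Y t $ j)" if "t \<le> N" "0 < l t" for t
      using cd[OF that] by (simp add: d_def sum.distrib sum_distrib_left)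
    have "(\<Sum>t\<le>N. l t * (f t j + c t * s j)) = y $ j" for j
    proof -
      have "(\<Sum>t\<le>N. l t * (f t j + c t * s j))
          = (\<Sum>t\<le>N. l t * f t j) + (\<Sum>t\<le>N. l t * c t) * s j"
        by (simp add: distrib_left sum.distrib sum_distrib_right mult.assoc)
      then show ?thesis by (simp add: c1 s_def)
    qed
    then show "y = (\<Sum>t\<le>N. l t *\<^sub>R ?Y t)"
      by (simp add: vec_eq_iff sum_component)
  qed
qed

lemma convex_separate_relaxation:
  fixes F :: "'k::finite \<Rightarrow> (real \<times> (real^'n)) set"
  assumes F: "\<And>j. convex (F j)" and G: "convex G"
  shows "convex {(y :: real^'k, z :: real^'n). (\<forall>i. z $ i \<in> {0..1}) \<and>
    (\<forall>j. (y $ j, 1 - z) \<in> F j) \<and> ((\<Sum>j\<in>UNIV. y $ j), 1 - z) \<in> G}" (is "convex ?R")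
proof (rule convexI)
  fix p q :: "(real^'k) \<times> (real^'n)" and a b :: real
  assume pR: "p \<in> ?R" and qR: "q \<in> ?R" and ab: "0 \<le> a" "0 \<le> b" "a + b = 1"
  obtain y z y' z' where p: "p = (y, z)" and q: "q = (y', z')" by (cases p, cases q) auto
  have x: "1 - (a *\<^sub>R z + b *\<^sub>R z') = a *\<^sub>R (1 - z) + b *\<^sub>R (1 - z')"
    using ab(3) by (simp add: vec_eq_iff algebra_simps)
  have "(a *\<^sub>R z + b *\<^sub>R z') $ i \<in> {0..1}" for i
  proof -
    have "z $ i \<in> {0..1}" "z' $ i \<in> {0..1}" using pR qR by (auto simp: p q)
    from convexD[OF convex_real_interval(5) this ab] show ?thesis by simp
  qed
  moreover have "((a *\<^sub>R y + b *\<^sub>R y') $ j, 1 - (a *\<^sub>R z + b *\<^sub>R z')) \<in> F j" for j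
  proof -
    have "(y $ j, 1 - z) \<in> F j" "(y' $ j, 1 - z') \<in> F j" using pR qR by (auto simp: p q)
    from convexD[OF F this ab] show ?thesis by (simp add: x)
  qed
  moreover have "((\<Sum>j\<in>UNIV. (a *\<^sub>R y + b *\<^sub>R y') $ j), 1 - (a *\<^sub>R z + b *\<^sub>R z')) \<in> G"
  proof -
    have "((\<Sum>j\<in>UNIV. y $ j), 1 - z) \<in> G" "((\<Sum>j\<in>UNIV. y' $ j), 1 - z') \<in> G"
      using pR qR by (auto simp: p q)
    from convexD[OF G this ab] show ?thesis
      by (simp add: x sum.distrib flip: sum_distrib_left)
  qed
  ultimately show "a *\<^sub>R p + b *\<^sub>R q \<in> ?R" by (simp add: p q)
qed

theorem proposition5:
  fixes W :: "real^'k^'n" and \<epsilon> :: real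
  assumes "\<And>i j. W $ i $ j \<ge> 0" and "\<epsilon> \<ge> 0"
    and "negligible_I_bar W \<epsilon>"
    and "ereal \<epsilon> \<le> L_W W \<epsilon>"
  shows "convex hull (joint_mixing_set W \<epsilon>) =
    {(y, z). (\<forall>i. z $ i \<in> {0..1}) \<and>
       (\<forall>j. (y $ j, 1 - z) \<in> convex hull (Q_epi (f_mix W j))) \<and>
       ((\<Sum>j\<in>UNIV. y $ j), 1 - z) \<in> convex hull (Q_epi (g_mix W \<epsilon>))}"
    (is "_ = ?R")
proof
  note W = assms(1)
  have "p \<in> ?R" if "p \<in> joint_mixing_set W \<epsilon>" for p
  proof -
    obtain y z where p: "p = (y, z)" by (cases p)
    have z: "z \<in> binary_vectors" using that by (simp add: p joint_mixing_set_def)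
    then obtain A where A: "1 - z = ind A"
      using complement_mem_binary_vectors binary_vectors_eq_range_ind by blast
    then have zA: "z = 1 - ind A" by (metis diff_diff_eq2 add_diff_cancel_left')
    have "(\<forall>j. f_mix W j (ind A) \<le> y $ j) \<and> g_mix W \<epsilon> (ind A) \<le> (\<Sum>j\<in>UNIV. y $ j)"
      using that unfolding p zA complement_mem_joint_mixing_set_iff[OF W] .
    then have "(y $ j, ind A) \<in> Q_epi (f_mix W j)"
      and "((\<Sum>j\<in>UNIV. y $ j), ind A) \<in> Q_epi (g_mix W \<epsilon>)" for j
      by (auto simp: Q_epi_def binary_vectors_eq_range_ind)
    then show ?thesis by (simp add: p zA hull_inc)
  qed
  then show "convex hull (joint_mixing_set W \<epsilon>) \<subseteq> ?R"
    by (intro hull_minimal convex_separate_relaxation convex_convex_hull subsetI)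
  show "?R \<subseteq> convex hull (joint_mixing_set W \<epsilon>)"
  proof
    fix p assume pR: "p \<in> ?R"
    obtain y z where p: "p = (y, z)" by (cases p)
    have z: "z $ i \<in> {0..1}" for i using pR by (auto simp: p)
    have "(1 - z) $ i \<in> {0..1}" for i using z[of i] by simp
    then obtain v :: "nat \<Rightarrow> 'n" and N l where v: "bij_betw v {..<N} UNIV"
      and l: "\<And>t. 0 \<le> l t" and sum1: "sum l {..N} = 1"
      and x: "1 - z = (\<Sum>t\<le>N. l t *\<^sub>R ind (v ` {..<t}))"
      using chain_decomposition[of "1 - z"] by blast
    let ?S = "\<lambda>t. ind (v ` {..<t})"
    have "(\<Sum>t\<le>N. l t * f_mix W j (?S t)) \<le> y $ j" for j
      using pR by (intro Lovasz_extension_le[OF submodular_f_mix[OF W] v sum1 x]) (simp add: p)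
    moreover have "(\<Sum>t\<le>N. l t * g_mix W \<epsilon> (?S t)) \<le> (\<Sum>j\<in>UNIV. y $ j)"
      using pR by (intro Lovasz_extension_le[OF submodular_g_mix[OF assms] v sum1 x]) (simp add: p)
    moreover have "(\<Sum>j\<in>UNIV. f_mix W j (?S t)) \<le> g_mix W \<epsilon> (?S t)" for t
      by (simp add: g_mix_def)
    ultimately obtain Y where Yf: "\<And>t j. f_mix W j (?S t) \<le> Y t $ j"
      and Yg: "\<And>t. t \<le> N \<Longrightarrow> 0 < l t \<Longrightarrow> g_mix W \<epsilon> (?S t) \<le> (\<Sum>j\<in>UNIV. Y t $ j)"
      and y: "y = (\<Sum>t\<le>N. l t *\<^sub>R Y t)"
      using split_along_weights[where f = "\<lambda>t j. f_mix W j (?S t)" and g = "\<lambda>t. g_mix W \<epsilon> (?S t)",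
          OF l sum1] by blast
    have zsum: "z = (\<Sum>t\<le>N. l t *\<^sub>R (1 - ?S t))"
    proof -
      have "(\<Sum>t\<le>N. l t *\<^sub>R (1 - ?S t)) = sum l {..N} *\<^sub>R 1 - (1 - z)"
        by (simp add: x scaleR_diff_right sum_subtractf flip: scaleR_left.sum)
      then show ?thesis by (simp add: sum1)
    qed
    \<comment> \<open>Segments of weight \<open>0\<close> carry no bound on their sum, so they are left out.\<close>
    let ?T = "{t \<in> {..N}. 0 < l t}"
    have drop: "(\<Sum>t\<in>?T. l t *\<^sub>R u t) = (\<Sum>t\<le>N. l t *\<^sub>R u t)" for u :: "nat \<Rightarrow> 'b::real_vector"
      by (rule sum.mono_neutral_left) (use l in \<open>auto simp: order.order_iff_strict\<close>)
    have T1: "sum l ?T = 1" using drop[of "\<lambda>_. 1 :: real"] sum1 by simp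
    have "(\<Sum>t\<in>?T. l t *\<^sub>R (Y t, 1 - ?S t)) \<in> convex hull (joint_mixing_set W \<epsilon>)"
    proof (rule convex_sum)
      show "(Y t, 1 - ?S t) \<in> convex hull (joint_mixing_set W \<epsilon>)" if "t \<in> ?T" for t
        using that Yf Yg by (auto simp: complement_mem_joint_mixing_set_iff[OF W] intro!: hull_inc)
    qed (use T1 l in auto)
    also have "(\<Sum>t\<in>?T. l t *\<^sub>R (Y t, 1 - ?S t)) = p"
      unfolding drop by (simp add: prod_eq_iff p fst_sum snd_sum flip: y zsum)
    finally show "p \<in> convex hull (joint_mixing_set W \<epsilon>)" .
  qed
qed

end
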